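(* For every pair of convex bodies $C,D\subset\mathbb{R}^2$, and every packing $S$ of $n$ positive homothets of $C$ in $D$, we have $$\mathrm{per}(S)\le\rho(C,D)\,\bigl(\mathrm{esc}(S)+\log n\bigr),$$ where $\rho(C,D)$ depends on $C$ and $D$ (and not on $n$ or $S$).
   Context: A convex body is a compact convex subset of $\mathbb{R}^2$ with nonempty interior. A positive homothet of $C$ is a set of the form $\mu C + v$ with $\mu>0$ and $v\in\mathbb{R}^2$. A finite set $S=\{C_1,\dots,C_n\}$ of convex bodies is a packing in a convex body $D$ if all $C_i$ are contained in $D$ and the $C_i$ have pairwise disjoint interiors. $\mathrm{per}(C)$ denotes the perimeter of a convex body $C$, and $\mathrm{per}(S)=\sum_{i=1}^n\mathrm{per}(C_i)$. For a convex body $K\subset D$, the escape distance $\mathrm{esc}(K)$ is the (minimum Euclidean) distance between $K$ and the boundary $\partial D$ of $D$; for a packing $S=\{C_1,\dots,C_n\}$ in $D$, $\mathrm{esc}(S)=\sum_{i=1}^n\mathrm{esc}(C_i)$. $\log$ denotes the logarithm to base 2.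
   Formalization: The inequality is stated for packings of n ≥ 2 homothets; for n = 1 it fails for every C and D, e.g. C = D and S = {D} gives per(S) > 0 while esc(S) + log 1 = 0. *)

theory Defs
  imports "HOL-Analysis.Analysis"
begin

definition convex_body :: "(real^2) set \<Rightarrow> bool" where
  "convex_body K \<longleftrightarrow> compact K \<and> convex K \<and> interior K \<noteq> {}"

definition positive_homothet :: "(real^2) set \<Rightarrow> (real^2) set \<Rightarrow> bool" where
  "positive_homothet C K \<longleftrightarrow> (\<exists>\<mu> v. \<mu> > 0 \<and> K = (\<lambda>x. \<mu> *\<^sub>R x + v) ` C)"

text \<open>A packing is a set rather than an indexed family. Nothing is lost: convex bodies with
  pairwise disjoint interiors are distinct, because their interiors are nonempty.\<close>

definition packing :: "(real^2) set set \<Rightarrow> (real^2) set \<Rightarrow> bool" where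
  "packing S D \<longleftrightarrow> finite S \<and> (\<forall>K\<in>S. convex_body K \<and> K \<subseteq> D) \<and>
     pairwise (\<lambda>K L. interior K \<inter> interior L = {}) S"

text \<open>Arc length of a path: the supremum of the lengths of the inscribed polygonal lines.\<close>

definition curve_length :: "(real \<Rightarrow> real^2) \<Rightarrow> ennreal" where
  "curve_length g = (SUP ts\<in>{ts. sorted ts \<and> set ts \<subseteq> {0..1}}.
     ennreal (\<Sum>i<length ts - 1. dist (g (ts ! i)) (g (ts ! Suc i))))"

text \<open>The perimeter is the arc length of the boundary curve. For a convex body \<open>K\<close> the boundary
  is a rectifiable Jordan curve, and all its simple closed parametrisations have the same length.
  The infimum below therefore ranges over a single finite value; it only serves to pick out
  that value without choosing a parametrisation.\<close>

definition perimeter :: "(real^2) set \<Rightarrow> real" where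
  "perimeter K = enn2real (INF g\<in>{g. simple_path g \<and> pathfinish g = pathstart g \<and>
     path_image g = frontier K}. curve_length g)"

definition total_perimeter :: "(real^2) set set \<Rightarrow> real" where
  "total_perimeter S = (\<Sum>K\<in>S. perimeter K)"

definition escape_distance :: "(real^2) set \<Rightarrow> (real^2) set \<Rightarrow> real" where
  "escape_distance D K = setdist K (frontier D)"

definition total_escape_distance :: "(real^2) set \<Rightarrow> (real^2) set set \<Rightarrow> real" where
  "total_escape_distance D S = (\<Sum>K\<in>S. escape_distance D K)"

end

theory Submission
  imports Defs
begin

text \<open>The perimeter of \<open>\<mu> C + v\<close> is \<open>\<mu>\<close> times that of \<open>C\<close>, so it suffices to bound the sum of the
  ratios \<open>\<mu>\<close>. Homothets with escape distance at least \<open>\<mu>\<close> are paid for by their escape distance.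
  The others with \<open>\<mu> \<le> s\<close> lie in a strip of width \<open>O(s)\<close> along the boundary of \<open>D\<close>, whose area is
  \<open>O(s)\<close>; as the interiors are disjoint, the sum of their \<open>\<mu>\<^sup>2\<close> is \<open>O(s)\<close>. Hence each of the first
  \<open>O(log n)\<close> dyadic classes of ratios contributes \<open>O(1)\<close>, and the remaining at most \<open>n\<close> homothets have
  ratios \<open>O(1/n)\<close>. The strip is controlled by shrinking \<open>D\<close> towards the centre of an inscribed ball.\<close>

section \<open>Scaling of the perimeter under homotheties\<close>

lemma frontier_homothety:
  fixes C :: "'a::euclidean_space set"
  assumes "\<mu> \<noteq> 0"
  shows "frontier ((\<lambda>x. \<mu> *\<^sub>R x + v) ` C) = (\<lambda>x. \<mu> *\<^sub>R x + v) ` frontier C"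
proof -
  have lin: "linear (\<lambda>x::'a. \<mu> *\<^sub>R x)"
    by (rule linear_scaleR)
  have inj: "inj (\<lambda>x::'a. \<mu> *\<^sub>R x)"
    using assms by (auto intro: injI)
  have "bij (\<lambda>x::'a. \<mu> *\<^sub>R x)"
    using inj lin by (simp add: bij_def linear_inj_imp_surj)
  then have scale: "frontier ((\<lambda>x. \<mu> *\<^sub>R x) ` C) = (\<lambda>x. \<mu> *\<^sub>R x) ` frontier C"
    unfolding frontier_def
    by (metis closure_scaleR image_set_diff inj interior_bijective_linear_image lin)
  have "(\<lambda>x. \<mu> *\<^sub>R x + v) ` B = (+) v ` (\<lambda>x. \<mu> *\<^sub>R x) ` B" for B
    by (auto simp: image_image add.commute)
  then show ?thesis
    by (simp add: frontier_translation scale)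
qed

lemma simple_path_homothety:
  fixes g :: "real \<Rightarrow> 'a::euclidean_space"
  assumes "\<mu> \<noteq> 0"
  shows "simple_path ((\<lambda>x. \<mu> *\<^sub>R x + v) \<circ> g) \<longleftrightarrow> simple_path g"
proof -
  have inj: "inj (\<lambda>x::'a. \<mu> *\<^sub>R x)"
    using assms by (auto intro: injI)
  have "(\<lambda>x. \<mu> *\<^sub>R x + v) \<circ> g = (\<lambda>x. v + x) \<circ> ((\<lambda>x. \<mu> *\<^sub>R x) \<circ> g)"
    by (auto simp: add.commute)
  then show ?thesis
    by (simp only: simple_path_translation_eq simple_path_linear_image_eq[OF linear_scaleR inj])
qed

lemma curve_length_homothety:
  assumes "\<mu> > 0"
  shows "curve_length ((\<lambda>x. \<mu> *\<^sub>R x + v) \<circ> g) = ennreal \<mu> * curve_length g"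
proof -
  have "dist (\<mu> *\<^sub>R x + v) (\<mu> *\<^sub>R y + v) = \<mu> * dist x y" for x y :: "real^2"
    using assms by (simp add: dist_norm flip: scaleR_diff_right)
  then show ?thesis
    using assms unfolding curve_length_def
    by (subst SUP_mult_left_ennreal) (simp add: ennreal_mult' flip: sum_distrib_left)
qed

text \<open>The infimum inside \<open>perimeter\<close>, kept in \<open>ennreal\<close> so that
  infima can be compared before passing to real numbers.\<close>

definition boundary_length :: "(real^2) set \<Rightarrow> ennreal" where
  "boundary_length K = (INF g\<in>{g. simple_path g \<and> pathfinish g = pathstart g \<and>
     path_image g = frontier K}. curve_length g)"

text \<open>Composition with the homothety turns every admissible parametrisation for
  \<open>K\<close> into one for the image, \<open>\<mu>\<close> times as long. With the factor
  \<open>1 / \<mu>\<close> on the left, the bound can be checked one parametrisation at a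
  time.\<close>

lemma boundary_length_homothety_le:
  assumes "\<mu> > 0"
  shows "ennreal (1 / \<mu>) * boundary_length ((\<lambda>x. \<mu> *\<^sub>R x + v) ` K) \<le> boundary_length K"
  unfolding boundary_length_def[of K]
proof (rule INF_greatest)
  let ?f = "\<lambda>x. \<mu> *\<^sub>R x + v"
  fix g assume "g \<in> {g. simple_path g \<and> pathfinish g = pathstart g \<and> path_image g = frontier K}"
  then have "boundary_length (?f ` K) \<le> curve_length (?f \<circ> g)"
    using assms unfolding boundary_length_def
    by (intro INF_lower)
      (simp add: simple_path_homothety frontier_homothety path_image_compose
        pathfinish_compose pathstart_compose)
  then have "ennreal (1 / \<mu>) * boundary_length (?f ` K)
      \<le> ennreal (1 / \<mu>) * (ennreal \<mu> * curve_length g)"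
    using assms by (intro mult_left_mono) (simp_all add: curve_length_homothety)
  also have "\<dots> = curve_length g"
    using assms by (simp flip: mult.assoc ennreal_mult)
  finally show "ennreal (1 / \<mu>) * boundary_length (?f ` K) \<le> curve_length g" .
qed

lemma perimeter_homothety:
  assumes "\<mu> > 0"
  shows "perimeter ((\<lambda>x. \<mu> *\<^sub>R x + v) ` K) = \<mu> * perimeter K"
proof -
  let ?K = "(\<lambda>x. \<mu> *\<^sub>R x + v) ` K"
  \<comment> \<open>The inverse homothety, fed into the same one-sided bound, yields the reverse
    inequality.\<close>
  have "(\<lambda>x. (1 / \<mu>) *\<^sub>R x + (- (1 / \<mu>) *\<^sub>R v)) ` ?K = K"
    using assms by (simp add: image_image scaleR_add_right)
  then have "ennreal \<mu> * boundary_length K \<le> boundary_length ?K"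
    using boundary_length_homothety_le[of "1 / \<mu>" "- (1 / \<mu>) *\<^sub>R v" ?K] assms by simp
  moreover have "ennreal \<mu> * (ennreal (1 / \<mu>) * boundary_length ?K)
      \<le> ennreal \<mu> * boundary_length K"
    using assms by (intro mult_left_mono boundary_length_homothety_le) auto
  then have "boundary_length ?K \<le> ennreal \<mu> * boundary_length K"
    using assms by (simp flip: mult.assoc ennreal_mult)
  ultimately have "boundary_length ?K = ennreal \<mu> * boundary_length K"
    by (rule antisym[rotated])
  moreover have "perimeter A = enn2real (boundary_length A)" for A
    by (simp add: perimeter_def boundary_length_def)
  ultimately show ?thesis
    using assms by (simp add: enn2real_mult)
qed

section \<open>Area of a strip along the boundary\<close>

lemma measure_homothety:
  fixes C :: "(real^2) set"
  assumes "\<mu> \<ge> 0"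
  shows "measure lebesgue ((\<lambda>x. \<mu> *\<^sub>R x + v) ` C) = \<mu>\<^sup>2 * measure lebesgue C"
  using measure_lebesgue_affine[of \<mu> v C] assms
  by (simp add: add.commute power2_eq_square)

text \<open>By convexity \<open>D\<close> contains every combination of \<open>d\<close>, with
  weight \<open>1 - l\<close>, and a point of the inscribed ball, with weight \<open>l\<close>.
  These fill an open ball of radius \<open>l * r\<close>, which lies in the interior of
  \<open>D\<close> and so misses the frontier.\<close>

lemma dist_frontier_shrunk_body:
  fixes D :: "'a::real_normed_vector set"
  assumes "convex D" and ball: "ball p r \<subseteq> D" and l: "0 < l" "l \<le> 1"
    and d: "d \<in> D" and z: "z \<in> frontier D"
  shows "l * r \<le> dist ((1 - l) *\<^sub>R d + l *\<^sub>R p) z"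
proof (rule ccontr)
  let ?x = "(1 - l) *\<^sub>R d + l *\<^sub>R p"
  assume "\<not> ?thesis"
  then have "z \<in> ball ?x (l * r)" by simp
  moreover have "ball ?x (l * r) \<subseteq> D"
  proof
    fix y assume "y \<in> ball ?x (l * r)"
    then have y: "norm (y - ?x) < l * r" by (simp add: dist_norm norm_minus_commute)
    define q where "q = p + (1 / l) *\<^sub>R (y - ?x)"
    have "norm (q - p) < r"
      using y l by (simp add: q_def divide_simps mult.commute)
    then have "q \<in> D"
      using ball by (auto simp: dist_norm norm_minus_commute)
    moreover have "y = (1 - l) *\<^sub>R d + l *\<^sub>R q"
      using l by (simp add: q_def scaleR_add_right)
    ultimately show "y \<in> D"
      using \<open>convex D\<close> d l by (simp add: convexD)
  qed
  then have "ball ?x (l * r) \<subseteq> interior D"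
    by (simp add: interior_maximal)
  ultimately show False
    using z by (auto simp: frontier_def)
qed

lemma boundary_strip_measure:
  fixes D :: "(real^2) set"
  assumes D: "compact D" "convex D" and ball: "ball p r \<subseteq> D" and "r > 0" "t > 0"
    and A: "A \<in> lmeasurable" "A \<subseteq> D"
    and near: "\<And>x. x \<in> A \<Longrightarrow> \<exists>z\<in>frontier D. dist x z < t"
  shows "measure lebesgue A \<le> 2 * (t / r) * measure lebesgue D"
proof -
  \<comment> \<open>With this \<open>l\<close>, every point of \<open>D\<close> shrunk towards
    \<open>p\<close> by the factor \<open>1 - l\<close> is at distance at least
    \<open>l * r = t\<close> from the frontier. Hence \<open>A\<close> avoids the shrunk copy; for
    \<open>l > 1\<close> there is no such copy, but the area of \<open>D\<close> is already a
    sufficient bound.\<close>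
  define l where "l = t / r"
  have l: "l > 0" "l * r = t" using \<open>r > 0\<close> \<open>t > 0\<close> by (auto simp: l_def)
  have mD: "D \<in> lmeasurable" using D by (simp add: lmeasurable_compact)
  have "measure lebesgue A \<le> 2 * l * measure lebesgue D"
  proof (cases "l \<le> 1")
    case False
    have "measure lebesgue A \<le> 1 * measure lebesgue D"
      using A mD by (simp add: measure_mono_fmeasurable)
    also have "\<dots> \<le> 2 * l * measure lebesgue D"
      using False by (intro mult_right_mono) auto
    finally show ?thesis .
  next
    case True
    let ?D = "(\<lambda>x. (1 - l) *\<^sub>R x + l *\<^sub>R p) ` D"
    have "compact ?D"
      using D by (intro compact_continuous_image continuous_intros)
    then have mD': "?D \<in> lmeasurable" by (simp add: lmeasurable_compact)
    have sub: "?D \<subseteq> D"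
      using D ball \<open>r > 0\<close> l True by (auto intro!: convexD simp: subset_iff)
    have "A \<subseteq> D - ?D"
      using near dist_frontier_shrunk_body[OF D(2) ball l(1) True] A(2) l(2) by fastforce
    then have "measure lebesgue A \<le> measure lebesgue (D - ?D)"
      using A mD mD' by (intro measure_mono_fmeasurable fmeasurable.Diff) auto
    also have "\<dots> = measure lebesgue D - (1 - l)\<^sup>2 * measure lebesgue D"
      using measurable_measure_Diff[OF mD _ sub] mD' measure_homothety[of "1 - l" "l *\<^sub>R p" D] True
      by (simp add: fmeasurableD)
    also have "\<dots> = (2 * l - l\<^sup>2) * measure lebesgue D"
      by (simp add: power2_eq_square algebra_simps)
    also have "\<dots> \<le> 2 * l * measure lebesgue D"
      by (intro mult_right_mono) auto
    finally show ?thesis .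
  qed
  then show ?thesis by (simp add: l_def)
qed

section \<open>Additivity of area in a packing\<close>

text \<open>A common point is not interior to both sets, so it lies on one of the two frontiers,
  which are null sets by convexity.\<close>

lemma convex_disjoint_interiors_negligible:
  fixes K L :: "'a::euclidean_space set"
  assumes "convex K" "convex L" "interior K \<inter> interior L = {}"
  shows "negligible (K \<inter> L)"
proof (rule negligible_subset)
  show "negligible (frontier K \<union> frontier L)"
    using assms by (simp add: negligible_convex_frontier)
  show "K \<inter> L \<subseteq> frontier K \<union> frontier L"
    using assms(3) closure_subset by (fastforce simp: frontier_def)
qed

lemma convex_body_measure_pos:
  assumes "convex_body C"
  shows "measure lebesgue C > 0"
proof -
  have "C \<in> lmeasurable" using assms by (simp add: convex_body_def lmeasurable_compact)
  moreover have "\<not> negligible C"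
    using assms unfolding convex_body_def
    by (metis interior_subset negligible_subset open_interior open_not_negligible)
  ultimately show ?thesis
    by (simp add: negligible_iff_measure zero_less_measure_iff measure_nonneg order_less_le)
qed

lemma packing_measure:
  assumes "packing S D" "T \<subseteq> S"
  shows "(\<Union>T) \<in> lmeasurable" "measure lebesgue (\<Union>T) = (\<Sum>K\<in>T. measure lebesgue K)"
proof -
  have fin: "finite T"
    using assms by (auto simp: packing_def intro: finite_subset)
  have meas: "K \<in> lmeasurable" if "K \<in> T" for K
    using assms that by (auto simp: packing_def convex_body_def intro: lmeasurable_compact)
  show "(\<Union>T) \<in> lmeasurable"
    using fin meas by (intro fmeasurable.finite_Union) auto
  have "pairwise (\<lambda>K L. negligible (K \<inter> L)) T"
  proof (rule pairwiseI)
    fix K L assume KL: "K \<in> T" "L \<in> T" "K \<noteq> L"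
    then have "convex K" "convex L"
      using assms by (auto simp: packing_def convex_body_def)
    moreover have "interior K \<inter> interior L = {}"
      using assms KL unfolding packing_def pairwise_def by (meson subsetD)
    ultimately show "negligible (K \<inter> L)"
      by (rule convex_disjoint_interiors_negligible)
  qed
  then show "measure lebesgue (\<Union>T) = (\<Sum>K\<in>T. measure lebesgue K)"
    using fin meas by (intro measure_negligible_finite_Union) auto
qed

section \<open>Summation over dyadic scales\<close>

text \<open>Each induction step halves \<open>s\<close>. A value above \<open>s / 2\<close> is at
  most \<open>2 / s\<close> times its square, so the values between \<open>s / 2\<close> and
  \<open>s\<close> sum to at most \<open>2 * B\<close>. After \<open>m\<close> halvings the
  remaining values are at most \<open>s / 2 ^ m\<close> each.\<close>

lemma dyadic_sum_bound:
  fixes f :: "'a \<Rightarrow> real"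
  assumes "finite I" and "\<And>i. i \<in> I \<Longrightarrow> f i > 0"
    and "\<And>s. s > 0 \<Longrightarrow> (\<Sum>i\<in>{i\<in>I. f i \<le> s}. (f i)\<^sup>2) \<le> B * s"
    and "s > 0"
  shows "(\<Sum>i\<in>{i\<in>I. f i \<le> s}. f i) \<le> 2 * B * real m + real (card I) * s / 2 ^ m"
  using \<open>s > 0\<close>
proof (induction m arbitrary: s)
  case 0
  have "(\<Sum>i\<in>{i\<in>I. f i \<le> s}. f i) \<le> real (card {i\<in>I. f i \<le> s}) * s"
    by (rule sum_bounded_above) auto
  also have "\<dots> \<le> real (card I) * s"
    using assms(1) 0 by (intro mult_right_mono) (auto intro: card_mono)
  finally show ?case by simp
next
  case (Suc m)
  let ?hi = "{i\<in>I. f i \<le> s \<and> s / 2 < f i}"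
  have "s / 2 * (\<Sum>i\<in>?hi. f i) \<le> (\<Sum>i\<in>?hi. (f i)\<^sup>2)"
    unfolding sum_distrib_left power2_eq_square
    using assms(2) by (intro sum_mono mult_right_mono) (auto simp: less_imp_le)
  also have "\<dots> \<le> (\<Sum>i\<in>{i\<in>I. f i \<le> s}. (f i)\<^sup>2)"
    using assms(1) by (intro sum_mono2) auto
  also have "\<dots> \<le> s / 2 * (2 * B)"
    using assms(3)[OF Suc.prems] by (simp add: mult.commute)
  finally have hi: "(\<Sum>i\<in>?hi. f i) \<le> 2 * B"
    by (rule mult_left_le_imp_le) (use Suc.prems in simp)
  have "{i\<in>I. f i \<le> s} = {i\<in>I. f i \<le> s / 2} \<union> ?hi"
    using Suc.prems by auto
  then have "(\<Sum>i\<in>{i\<in>I. f i \<le> s}. f i) = (\<Sum>i\<in>{i\<in>I. f i \<le> s / 2}. f i) + (\<Sum>i\<in>?hi. f i)"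
    using assms(1) by (simp only:) (rule sum.union_disjoint, auto)
  with Suc.IH[of "s / 2"] Suc.prems hi show ?case
    by (simp add: algebra_simps)
qed

text \<open>The hypothesis \<open>scale\<close> with \<open>s = f i\<close> already gives \<open>f i \<le> B\<close>, so the dyadic splitting
  can start at \<open>s = B\<close>.\<close>

lemma log_sum_bound:
  fixes f :: "'a \<Rightarrow> real"
  assumes "finite I" and pos: "\<And>i. i \<in> I \<Longrightarrow> f i > 0"
    and scale: "\<And>s. s > 0 \<Longrightarrow> (\<Sum>i\<in>{i\<in>I. f i \<le> s}. (f i)\<^sup>2) \<le> B * s"
    and "B > 0" and n: "card I \<le> n" "2 \<le> n"
  shows "(\<Sum>i\<in>I. f i) \<le> 5 * B * log 2 (real n)"
proof -
  have "f i \<le> B" if "i \<in> I" for i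
  proof -
    have "(f i)\<^sup>2 \<le> (\<Sum>j\<in>{j\<in>I. f j \<le> f i}. (f j)\<^sup>2)"
      using that assms(1) by (intro member_le_sum) auto
    also have "\<dots> \<le> B * f i" using scale pos[OF that] by blast
    finally show ?thesis using pos[OF that] by (simp add: power2_eq_square)
  qed
  then have all: "{i\<in>I. f i \<le> B} = I" by auto
  \<comment> \<open>Enough halvings for the remainder \<open>card I * B / 2 ^ m\<close> to be at
    most \<open>B\<close>.\<close>
  define m where "m = nat \<lceil>log 2 (real n)\<rceil>"
  have log1: "1 \<le> log 2 (real n)"
    using n by simp
  have "log 2 (real n) \<le> real m"
    unfolding m_def by linarith
  then have "real n \<le> 2 powr real m"
    using n by (simp add: log_le_iff)
  then have "real (card I) \<le> 2 ^ m"
    using n by (simp add: powr_realpow)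
  then have "real (card I) * B / 2 ^ m \<le> B"
    using \<open>B > 0\<close> by (simp add: divide_simps mult.commute)
  then have "(\<Sum>i\<in>I. f i) \<le> 2 * B * real m + B"
    using dyadic_sum_bound[of I f B B m] assms(1) pos scale \<open>B > 0\<close> all by force
  \<comment> \<open>Rounding up adds at most 1, which \<open>log 2 n\<close> dominates as
    \<open>n \<ge> 2\<close>. The constant 5 is 4 from the \<open>m\<close> scales plus 1 from the
    remainder.\<close>
  also have "real m \<le> 2 * log 2 (real n)"
    using log1 unfolding m_def by linarith
  then have "2 * B * real m + B \<le> 2 * B * (2 * log 2 (real n)) + B * log 2 (real n)"
    using \<open>B > 0\<close> log1 by (intro add_mono mult_left_mono) auto
  finally show ?thesis by (simp add: algebra_simps)
qed

section \<open>Homothets near the boundary and the final estimate\<close>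

text \<open>A member \<open>K\<close> has a point within \<open>\<mu> K\<close> of the frontier and
  diameter \<open>\<mu> K * diameter C\<close>, so all members lie in a strip of width
  \<open>s * (1 + diameter C)\<close>. Their areas add up to at most the area of that strip.\<close>

lemma near_boundary_area:
  assumes C: "convex_body C" and D: "convex_body D"
    and ball: "ball p r \<subseteq> D" "r > 0"
    and pack: "packing S D" and "T \<subseteq> S"
    and hom: "\<And>K. K \<in> T \<Longrightarrow> \<mu> K > 0 \<and> K = (\<lambda>x. \<mu> K *\<^sub>R x + v K) ` C"
    and esc: "\<And>K. K \<in> T \<Longrightarrow> escape_distance D K < \<mu> K"
    and s: "s > 0" "\<And>K. K \<in> T \<Longrightarrow> \<mu> K \<le> s"
  shows "(\<Sum>K\<in>T. (\<mu> K)\<^sup>2) * measure lebesgue C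
    \<le> 2 * (s * (1 + diameter C) / r) * measure lebesgue D"
proof -
  have bC: "bounded C" using C by (auto simp: convex_body_def compact_imp_bounded)
  have dpos: "0 \<le> diameter C" using bC by (rule diameter_ge_0)
  have near: "\<exists>z\<in>frontier D. dist x z < s * (1 + diameter C)" if x: "x \<in> \<Union>T" for x
  proof -
    obtain K where K: "K \<in> T" "x \<in> K" using x by auto
    \<comment> \<open>\<open>setdist\<close> to the empty set is 0, so a small escape distance
      produces a nearby frontier point only when the frontier is nonempty.\<close>
    have "frontier D \<noteq> {}"
      using D by (auto simp: convex_body_def frontier_eq_empty dest: compact_imp_bounded)
    then obtain y z where yz: "y \<in> K" "z \<in> frontier D" "dist y z < \<mu> K"
      using setdist_ltE[of K "frontier D" "\<mu> K"] esc[OF K(1)] K(2)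
      by (auto simp: escape_distance_def)
    obtain a b where ab: "a \<in> C" "b \<in> C" "x = \<mu> K *\<^sub>R a + v K" "y = \<mu> K *\<^sub>R b + v K"
      using hom[OF K(1)] K(2) yz(1) by blast
    have "dist x y = \<mu> K * dist a b"
      using hom[OF K(1)] by (simp add: ab dist_norm flip: scaleR_diff_right)
    also have "\<dots> \<le> \<mu> K * diameter C"
      using hom[OF K(1)] diameter_bounded_bound[OF bC ab(1,2)] by (simp add: mult_left_mono)
    finally have "dist x z < \<mu> K * diameter C + \<mu> K"
      using yz(3) dist_triangle[of x z y] by linarith
    also have "\<dots> = \<mu> K * (1 + diameter C)" by (simp add: algebra_simps)
    also have "\<dots> \<le> s * (1 + diameter C)"
      using s(2)[OF K(1)] dpos by (intro mult_right_mono) auto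
    finally show ?thesis using yz(2) by blast
  qed
  have "(\<Sum>K\<in>T. (\<mu> K)\<^sup>2) * measure lebesgue C = (\<Sum>K\<in>T. measure lebesgue K)"
    unfolding sum_distrib_right
  proof (rule sum.cong[OF refl])
    fix K assume "K \<in> T"
    from hom[OF this] show "(\<mu> K)\<^sup>2 * measure lebesgue C = measure lebesgue K"
      by (metis less_imp_le measure_homothety)
  qed
  also have "\<dots> = measure lebesgue (\<Union>T)"
    using packing_measure(2)[OF pack \<open>T \<subseteq> S\<close>] by simp
  also have "\<dots> \<le> 2 * (s * (1 + diameter C) / r) * measure lebesgue D"
  proof (rule boundary_strip_measure[OF _ _ ball])
    show "compact D" "convex D" using D by (auto simp: convex_body_def)
    show "0 < s * (1 + diameter C)" using s(1) dpos by simp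
    show "\<Union>T \<in> lmeasurable" by (rule packing_measure(1)[OF pack \<open>T \<subseteq> S\<close>])
    show "\<Union>T \<subseteq> D" using pack \<open>T \<subseteq> S\<close> by (auto simp: packing_def)
  qed (rule near)
  finally show ?thesis .
qed

theorem proposition4:
  fixes C D :: "(real^2) set"
  assumes "convex_body C" and "convex_body D"
  shows "\<exists>\<rho>::real. \<forall>(n::nat) (S::(real^2) set set).
    n \<ge> 2 \<and> packing S D \<and> card S = n \<and> (\<forall>K\<in>S. positive_homothet C K) \<longrightarrow>
    total_perimeter S \<le> \<rho> * (total_escape_distance D S + log 2 (real n))"
proof -
  obtain p where "p \<in> interior D" using assms(2) unfolding convex_body_def by blast
  then obtain r where ball: "ball p r \<subseteq> D" "r > 0" unfolding mem_interior by blast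
  \<comment> \<open>The bound of \<open>near_boundary_area\<close> divided by \<open>s\<close> and
    by the area of \<open>C\<close>, as \<open>log_sum_bound\<close> requires.\<close>
  define B where
    "B = 2 * ((1 + diameter C) / r) * measure lebesgue D / measure lebesgue C"
  have Cpos: "measure lebesgue C > 0" and Dpos: "measure lebesgue D > 0"
    using assms by (auto intro: convex_body_measure_pos)
  have "0 \<le> diameter C"
    using assms(1) by (auto simp: convex_body_def intro: diameter_ge_0 compact_imp_bounded)
  then have "B > 0" using Cpos Dpos ball(2) by (simp add: B_def)
  have "total_perimeter S
      \<le> (perimeter C * (1 + 5 * B)) * (total_escape_distance D S + log 2 (real n))"
    if n: "n \<ge> 2" "card S = n" and pack: "packing S D"
      and "\<forall>K\<in>S. positive_homothet C K" for n S
  proof -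
    obtain \<mu> v where hom: "\<And>K. K \<in> S \<Longrightarrow> \<mu> K > 0 \<and> K = (\<lambda>x. \<mu> K *\<^sub>R x + v K) ` C"
      using \<open>\<forall>K\<in>S. positive_homothet C K\<close> unfolding positive_homothet_def by metis
    have pos: "\<mu> K > 0" if "K \<in> S" for K
      using hom[OF that] by (rule conjunct1)
    have fin: "finite S" using pack by (simp add: packing_def)
    have esc0: "escape_distance D K \<ge> 0" for K by (simp add: escape_distance_def)
    let ?N = "{K\<in>S. escape_distance D K < \<mu> K}"
    have "(\<Sum>K\<in>?N. \<mu> K) \<le> 5 * B * log 2 (real n)"
    proof (rule log_sum_bound)
      show "card ?N \<le> n" unfolding n(2)[symmetric] using fin by (intro card_mono) auto
      fix s :: real assume "s > 0"
      let ?T = "{K\<in>?N. \<mu> K \<le> s}"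
      have "(\<Sum>K\<in>?T. (\<mu> K)\<^sup>2) * measure lebesgue C
          \<le> 2 * (s * (1 + diameter C) / r) * measure lebesgue D"
        by (rule near_boundary_area[OF assms ball pack, where v = v]) (use hom \<open>s > 0\<close> in blast)+
      also have "\<dots> = B * s * measure lebesgue C"
        using Cpos by (simp add: B_def)
      finally show "(\<Sum>K\<in>?T. (\<mu> K)\<^sup>2) \<le> B * s"
        using Cpos by (rule mult_right_le_imp_le)
    qed (use fin pos \<open>B > 0\<close> n in auto)
    moreover have "(\<Sum>K\<in>S - ?N. \<mu> K) \<le> (\<Sum>K\<in>S - ?N. escape_distance D K)"
      by (intro sum_mono) auto
    moreover have "\<dots> \<le> total_escape_distance D S"
      unfolding total_escape_distance_def using fin esc0 by (intro sum_mono2) auto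
    moreover have "(\<Sum>K\<in>S. \<mu> K) = (\<Sum>K\<in>S - ?N. \<mu> K) + (\<Sum>K\<in>?N. \<mu> K)"
      using fin by (intro sum.subset_diff) auto
    ultimately have
      "(\<Sum>K\<in>S. \<mu> K) \<le> total_escape_distance D S + 5 * B * log 2 (real n)"
      by linarith
    \<comment> \<open>Both summands are nonnegative, so their coefficients 1 and
      \<open>5 * B\<close> can be raised to the common value \<open>1 + 5 * B\<close>.\<close>
    also have "\<dots> \<le> (1 + 5 * B) * (total_escape_distance D S + log 2 (real n))"
    proof -
      have "0 \<le> 5 * B * total_escape_distance D S" "0 \<le> log 2 (real n)"
        using esc0 \<open>B > 0\<close> n by (auto simp: total_escape_distance_def intro!: sum_nonneg mult_nonneg_nonneg)
      then show ?thesis by (simp add: algebra_simps)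
    qed
    finally have "perimeter C * (\<Sum>K\<in>S. \<mu> K)
        \<le> perimeter C * ((1 + 5 * B) * (total_escape_distance D S + log 2 (real n)))"
      by (rule mult_left_mono) (simp only: perimeter_def enn2real_nonneg)
    moreover have "total_perimeter S = (\<Sum>K\<in>S. perimeter C * \<mu> K)"
      unfolding total_perimeter_def
    proof (rule sum.cong[OF refl])
      fix K assume "K \<in> S"
      have "perimeter K = perimeter ((\<lambda>x. \<mu> K *\<^sub>R x + v K) ` C)"
        using hom[OF \<open>K \<in> S\<close>] by (intro arg_cong[where f = perimeter]) (rule conjunct2)
      also have "\<dots> = perimeter C * \<mu> K"
        using pos[OF \<open>K \<in> S\<close>] by (simp add: perimeter_homothety)
      finally show "perimeter K = perimeter C * \<mu> K" .
    qed
    ultimately show ?thesis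
      by (simp add: sum_distrib_left mult.assoc)
  qed
  then show ?thesis by blast
qed

end
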